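(* Let $-1<p<1$, $p\neq 0$. Let $K$ and $L$ be origin-symmetric convex bodies in $\mathbb{R}^n$ such that $(\mathbb{R}^n,\|\cdot\|_K)$ embeds in $L_p$ and $$\Gamma^*_p K\subset \Gamma^*_p L .$$ Then $\mathrm{vol}(L)\le \mathrm{vol}(K)$.
   Context: A convex body is a compact convex set with non-empty interior in $\mathbb{R}^n$; $\mathrm{vol}$ denotes $n$-dimensional Lebesgue measure, and $(x,\xi)$ is the standard inner product. The Minkowski functional of an origin-symmetric star body (in particular, of an origin-symmetric convex body) $K$ is $\|x\|_K=\min\{a\ge 0: x\in aK\}$. Polar $p$-centroid body: for $p>-1$, $p\ne 0$, the polar $p$-centroid body $\Gamma^*_pK$ of $K$ is the (possibly non-convex) body $\Gamma_p^*K=\{\xi:\|\xi\|_{\Gamma^*_pK}\le 1\}$ whose Minkowski functional is $$\|\xi\|_{\Gamma^*_p K}=\left(\frac{1}{\mathrm{vol}(K)}\int_K|(x,\xi)|^p\,dx\right)^{1/p},\quad \xi\in\mathbb{R}^n\setminus\{0\}.$$ Embedding in $L_p$: for $p>-1$, $p\neq0$, the space $(\mathbb{R}^n,\|\cdot\|)$ embeds in $L_p$ if there exists a finite (non-negative) Borel measure $\mu$ on the unit sphere $S^{n-1}$ such that for every $x\in\mathbb{R}^n\setminus\{0\}$, $\|x\|^p=\int_{S^{n-1}}|(x,\xi)|^p\,d\mu(\xi)$. *)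

theory Defs
  imports "HOL-Analysis.Analysis"
begin

definition convex_body :: "(real^'n) set \<Rightarrow> bool" where
  "convex_body K \<longleftrightarrow> compact K \<and> convex K \<and> interior K \<noteq> {}"

definition origin_symmetric :: "(real^'n) set \<Rightarrow> bool" where
  "origin_symmetric K \<longleftrightarrow> (\<forall>x\<in>K. - x \<in> K)"

definition vol :: "(real^'n) set \<Rightarrow> real" where
  "vol K = measure lebesgue K"

text \<open>For a least element of a set of reals, \<open>LEAST\<close> is the minimum. It exists for every
  \<open>x\<close> when \<open>K\<close> is an origin-symmetric convex body; the value is unspecified if no minimum exists.\<close>

definition minkowski_functional :: "(real^'n) set \<Rightarrow> real^'n \<Rightarrow> real" where
  "minkowski_functional K x = (LEAST a. 0 \<le> a \<and> x \<in> (\<lambda>y. a *\<^sub>R y) ` K)"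

text \<open>The Minkowski functional of the polar \<open>p\<close>-centroid body, with the usual value 0 at the origin.
  For \<open>p > -1\<close>, \<open>\<xi> \<noteq> 0\<close> and compact \<open>K\<close> the integrand is Lebesgue integrable on \<open>K\<close>. If \<open>p < 0\<close>,
  the convention \<open>0 powr p = 0\<close> only affects the points of \<open>K\<close> on the hyperplane orthogonal
  to \<open>\<xi>\<close>, a null set.\<close>

definition polar_centroid_functional :: "real \<Rightarrow> (real^'n) set \<Rightarrow> real^'n \<Rightarrow> real" where
  "polar_centroid_functional p K \<xi> =
     (if \<xi> = 0 then 0
      else (1 / vol K * (LINT x:K|lebesgue. \<bar>x \<bullet> \<xi>\<bar> powr p)) powr (1 / p))"

definition polar_centroid_body :: "real \<Rightarrow> (real^'n) set \<Rightarrow> (real^'n) set" where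
  "polar_centroid_body p K = {\<xi>. polar_centroid_functional p K \<xi> \<le> 1}"

text \<open>\<open>\<bar>t\<bar>\<^sup>p\<close> with values in \<open>[0, \<infinity>]\<close>, where \<open>0\<^sup>p = \<infinity>\<close> for \<open>p < 0\<close>. This matters in the definition
  of embedding below: the measure \<open>\<mu>\<close> may charge the great subsphere orthogonal to \<open>x\<close>, and
  then for \<open>p < 0\<close> the integral must diverge, whereas \<open>0 powr p = 0\<close> would ignore that part of \<open>\<mu>\<close>.\<close>

definition abs_powr :: "real \<Rightarrow> real \<Rightarrow> ennreal" where
  "abs_powr t p = (if t = 0 \<and> p < 0 then \<infinity> else ennreal (\<bar>t\<bar> powr p))"

text \<open>\<open>N\<close> is the (quasi-)norm of the space. For \<open>x \<noteq> 0\<close> the left-hand side below is finite,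
  so the integral is required to converge.\<close>

definition embeds_in_Lp :: "real \<Rightarrow> (real^'n \<Rightarrow> real) \<Rightarrow> bool" where
  "embeds_in_Lp p N \<longleftrightarrow>
     (\<exists>\<mu> :: (real^'n) measure.
        sets \<mu> = sets (restrict_space borel (sphere 0 1)) \<and> finite_measure \<mu> \<and>
        (\<forall>x. x \<noteq> 0 \<longrightarrow> ennreal (N x powr p) = (\<integral>\<^sup>+ \<xi>. abs_powr (x \<bullet> \<xi>) p \<partial>\<mu>)))"

end

(*
  Integrating the inclusion of the polar p-centroid bodies against the measure that represents the
  p-th power of the norm of K turns it, by Tonelli, into a comparison of the mean values of
  ||x||_K^p over K and over L: the mean over L is at most the mean over K if p > 0, and at least
  it if p < 0. If vol L > vol K, let t > 1 be such that vol (t K) = vol L. As t K is a sublevel set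
  of the norm, the mean over L is at least (p > 0) or at most (p < 0) the mean over t K, which is
  t^p times the mean over K. This mean is positive and finite, and t^p > 1 or t^p < 1 respectively,
  a contradiction.
*)
theory Submission
  imports Defs
begin

section \<open>The Minkowski functional of an origin-symmetric convex body\<close>

text \<open>If a ball around \<open>z\<close> lies in \<open>K\<close>, then a small
  \<open>y\<close> is the midpoint of \<open>z + y\<close> and \<open>y - z\<close>; the latter is
  the reflection of \<open>z - y\<close>, so both endpoints lie in \<open>K\<close>.\<close>

lemma origin_symmetric_zero_interior:
  assumes "convex_body K" "origin_symmetric K"
  shows "0 \<in> interior K"
proof -
  from assms obtain z where "z \<in> interior K" by (auto simp: convex_body_def)
  then obtain e where e: "e > 0" "ball z e \<subseteq> K" by (auto simp: mem_interior)
  have "y \<in> K" if "y \<in> ball 0 e" for y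
  proof -
    have 1: "z + y \<in> K" using e that by (auto simp: dist_norm subset_iff)
    have "z - y \<in> K" using e that by (auto simp: dist_norm subset_iff)
    then have 2: "y - z \<in> K" using assms(2) by (force simp: origin_symmetric_def)
    have "(1/2) *\<^sub>R (z + y) + (1/2) *\<^sub>R (y - z) \<in> K"
      using assms(1) 1 2 by (intro convexD) (auto simp: convex_body_def)
    also have "(1/2) *\<^sub>R (z + y) + (1/2) *\<^sub>R (y - z) = y"
      by (simp add: algebra_simps flip: scaleR_add_left)
    finally show ?thesis .
  qed
  then show ?thesis using e by (auto simp: mem_interior)
qed

text \<open>Later facts about the functional rest on this description of its sublevel sets as
  dilates of \<open>K\<close>, not on \<open>LEAST\<close>. Convexity and \<open>0 \<in> K\<close>
  make the dilates increase with the factor; compactness makes the minimum exist.\<close>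

lemma minkowski_functional_le_iff:
  assumes "convex_body K" "origin_symmetric K"
  shows "minkowski_functional K x \<le> a \<longleftrightarrow> 0 \<le> a \<and> x \<in> (\<lambda>y. a *\<^sub>R y) ` K"
proof -
  let ?P = "\<lambda>a. 0 \<le> a \<and> x \<in> (\<lambda>y. a *\<^sub>R y) ` K"
  have conv: "convex K" and comp: "compact K" using assms by (auto simp: convex_body_def)
  from origin_symmetric_zero_interior[OF assms] obtain e where e: "e > 0" "ball 0 e \<subseteq> K"
    by (auto simp: mem_interior)
  then have zero: "0 \<in> K" by auto
  have mono: "?P b" if "?P a" "a \<le> b" for a b
  proof (cases "b = 0")
    case False
    from that obtain y where y: "y \<in> K" "x = a *\<^sub>R y" by auto
    have "(a / b) *\<^sub>R y + (1 - a / b) *\<^sub>R 0 \<in> K"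
      using conv y zero that False by (intro convexD) auto
    moreover have "x = b *\<^sub>R ((a / b) *\<^sub>R y)" using y False by simp
    ultimately have "x \<in> (\<lambda>y. b *\<^sub>R y) ` K" by (intro image_eqI) auto
    then show ?thesis using that by simp
  qed (use that in auto)
  have "\<exists>m. ?P m \<and> (\<forall>b. ?P b \<longrightarrow> m \<le> b)"
  proof (cases "x = 0")
    case True
    then show ?thesis using zero by (intro exI[of _ 0]) auto
  next
    case False
    \<comment> \<open>The reciprocals of the positive admissible factors, together with 0. The
      factors are unbounded above, but \<open>S\<close> is compact, and its largest element
      \<open>s\<close> gives the least factor \<open>1 / s\<close>.\<close>
    define S where "S = {s. 0 \<le> s \<and> s *\<^sub>R x \<in> K}"
    obtain B where B: "\<And>y. y \<in> K \<Longrightarrow> norm y \<le> B"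
      using comp compact_imp_bounded bounded_iff by metis
    have "S = {0..} \<inter> (\<lambda>s. s *\<^sub>R x) -` K" by (auto simp: S_def)
    moreover have "closed ((\<lambda>s. s *\<^sub>R x) -` K)"
      by (intro continuous_closed_vimage compact_imp_closed comp) (auto intro!: continuous_intros)
    ultimately have "closed S" by (simp add: closed_Int)
    moreover have "bounded S"
    proof (rule boundedI[of _ "B / norm x"])
      fix s assume "s \<in> S"
      then have "0 \<le> s" "norm (s *\<^sub>R x) \<le> B" using B unfolding S_def by blast+
      then show "norm s \<le> B / norm x" using False by (simp add: field_simps)
    qed
    ultimately have "compact S" by (simp add: compact_eq_bounded_closed)
    moreover have "0 \<in> S" using zero by (simp add: S_def)
    ultimately obtain s where s: "s \<in> S" "\<And>r. r \<in> S \<Longrightarrow> r \<le> s"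
      using compact_attains_sup[of S] by auto
    \<comment> \<open>The point at distance \<open>e / 2\<close> from the origin on the ray through
      \<open>x\<close> lies in \<open>K\<close>, so the maximum of \<open>S\<close> is positive and
      can be inverted.\<close>
    have "(e / (2 * norm x)) *\<^sub>R x \<in> ball 0 e" using e False by simp
    then have "e / (2 * norm x) \<in> S" using e by (auto simp: S_def)
    then have spos: "s > 0" using s(2) e False
      by (smt (verit) divide_pos_pos zero_less_norm_iff)
    have "?P (1 / s)" using s(1) spos by (auto simp: S_def image_iff intro!: bexI[of _ "s *\<^sub>R x"])
    moreover have "1 / s \<le> b" if "?P b" for b
    proof -
      from that False have "b > 0" by (cases "b = 0") auto
      with that have "1 / b \<in> S" by (auto simp: S_def)
      then show ?thesis using s(2)[of "1 / b"] spos \<open>b > 0\<close> by (simp add: field_simps)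
    qed
    ultimately show ?thesis by blast
  qed
  then obtain m where m: "?P m" "\<And>b. ?P b \<Longrightarrow> m \<le> b" by blast
  have "minkowski_functional K x = m"
    unfolding minkowski_functional_def by (rule Least_equality) (use m in auto)
  then show ?thesis using m mono[of m a] by auto
qed

lemma minkowski_functional_nonneg:
  assumes "convex_body K" "origin_symmetric K"
  shows "0 \<le> minkowski_functional K x"
  using minkowski_functional_le_iff[OF assms, of x "minkowski_functional K x"] by simp

lemma minkowski_functional_pos:
  assumes "convex_body K" "origin_symmetric K" "x \<noteq> 0"
  shows "0 < minkowski_functional K x"
  using minkowski_functional_le_iff[OF assms(1,2), of x 0] assms(3) by force

lemma minkowski_functional_scaleR:
  assumes "convex_body K" "origin_symmetric K" "c > 0"
  shows "minkowski_functional K (c *\<^sub>R x) = c * minkowski_functional K x"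
proof -
  \<comment> \<open>One inequality is enough: used for \<open>1 / c\<close> at the point
    \<open>c *\<^sub>R x\<close>, it yields the reverse one for \<open>c\<close>.\<close>
  have *: "minkowski_functional K (c *\<^sub>R x) \<le> c * minkowski_functional K x" if "c > 0" for c x
  proof -
    obtain y where "y \<in> K" "x = minkowski_functional K x *\<^sub>R y"
      using minkowski_functional_le_iff[OF assms(1,2), of x "minkowski_functional K x"] by auto
    then have "c *\<^sub>R x = (c * minkowski_functional K x) *\<^sub>R y" by (metis scaleR_scaleR)
    then show ?thesis
      using \<open>y \<in> K\<close> that minkowski_functional_nonneg[OF assms(1,2), of x]
      by (subst minkowski_functional_le_iff[OF assms(1,2)]) auto
  qed
  from *[of "1 / c" "c *\<^sub>R x"] *[of c x] assms(3) show ?thesis by (simp add: field_simps)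
qed

text \<open>Sublevel sets are empty or dilates of a compact set, hence Borel.\<close>

lemma borel_measurable_minkowski_functional:
  fixes K :: "(real^'n) set"
  assumes "convex_body K" "origin_symmetric K"
  shows "minkowski_functional K \<in> borel_measurable borel"
  unfolding borel_measurable_iff_le
proof
  fix a
  have "{x. minkowski_functional K x \<le> a} = (if 0 \<le> a then (\<lambda>y. a *\<^sub>R y) ` K else {})"
    by (auto simp: minkowski_functional_le_iff[OF assms])
  moreover have "compact ((\<lambda>y. a *\<^sub>R y) ` K)"
    using assms by (auto simp: convex_body_def intro: compact_scaling)
  ultimately show "{x \<in> space borel. minkowski_functional K x \<le> a} \<in> sets borel"
    by (auto intro: borel_compact)
qed

section \<open>Dilations and the bathtub principle\<close>

lemma nn_integral_lborel_scaleR: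
  fixes f :: "'a::euclidean_space \<Rightarrow> ennreal"
  assumes [measurable]: "f \<in> borel_measurable borel" and "t > 0"
  shows "(\<integral>\<^sup>+x. f x \<partial>lborel) = ennreal (t ^ DIM('a)) * (\<integral>\<^sup>+x. f (t *\<^sub>R x) \<partial>lborel)"
  using assms(2)
  by (subst lborel_affine[of t 0]) (auto simp: nn_integral_density nn_integral_distr nn_integral_cmult)

text \<open>The common part \<open>A \<inter> B\<close> contributes equally to both sides. Of the
  remainders, \<open>A - B\<close> has at most the measure of \<open>B - A\<close>, and the
  threshold \<open>c\<close> separates the values of \<open>f\<close> on them. Finiteness of the
  measure of \<open>A\<close> allows the measure of the common part to be cancelled.\<close>

lemma nn_integral_bathtub:
  assumes [measurable]: "f \<in> borel_measurable M" "A \<in> sets M" "B \<in> sets M"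
    and le: "emeasure M A \<le> emeasure M B" and fin: "emeasure M A < \<infinity>"
    and A: "\<And>x. x \<in> A - B \<Longrightarrow> f x \<le> c" and B: "\<And>x. x \<in> B - A \<Longrightarrow> c \<le> f x"
  shows "(\<integral>\<^sup>+x\<in>A. f x \<partial>M) \<le> (\<integral>\<^sup>+x\<in>B. f x \<partial>M)"
proof -
  have split: "(\<integral>\<^sup>+x\<in>X. f x \<partial>M) = (\<integral>\<^sup>+x\<in>A \<inter> B. f x \<partial>M) + (\<integral>\<^sup>+x\<in>X - A \<inter> B. f x \<partial>M)"
    if [measurable]: "X \<in> sets M" and "A \<inter> B \<subseteq> X" for X
    using that(2)
    by (subst nn_integral_add[symmetric]) (auto intro!: nn_integral_cong split: split_indicator)
  have "emeasure M (A \<inter> B) + emeasure M (A - B) \<le> emeasure M (A \<inter> B) + emeasure M (B - A)"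
  proof -
    have "emeasure M (A \<inter> B) + emeasure M (A - B) = emeasure M A"
      "emeasure M (A \<inter> B) + emeasure M (B - A) = emeasure M B"
      by (subst plus_emeasure; (force intro: arg_cong[where f = "emeasure M"]))+
    then show ?thesis using le by simp
  qed
  moreover have "emeasure M (A \<inter> B) \<noteq> \<infinity>"
    using fin emeasure_mono[of "A \<inter> B" A M] by (auto simp: top_unique)
  ultimately have diff: "emeasure M (A - B) \<le> emeasure M (B - A)"
    by (simp add: ennreal_add_left_cancel_le)
  have "(\<integral>\<^sup>+x\<in>A - A \<inter> B. f x \<partial>M) \<le> (\<integral>\<^sup>+x\<in>A - B. c \<partial>M)"
    using A by (intro nn_integral_mono) (auto split: split_indicator)
  also have "\<dots> = c * emeasure M (A - B)" by (simp add: nn_integral_cmult_indicator)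
  also have "\<dots> \<le> c * emeasure M (B - A)" using diff by (intro mult_left_mono) auto
  also have "\<dots> = (\<integral>\<^sup>+x\<in>B - A. c \<partial>M)" by (simp add: nn_integral_cmult_indicator)
  also have "\<dots> \<le> (\<integral>\<^sup>+x\<in>B - A \<inter> B. f x \<partial>M)"
    using B by (intro nn_integral_mono) (auto split: split_indicator)
  finally show ?thesis
    by (subst (1 2) split) (auto intro: add_left_mono)
qed


text \<open>The change of variables contributes \<open>t ^ CARD('n)\<close> and the homogeneity of
  the functional contributes \<open>t powr p\<close>.\<close>

lemma nn_integral_minkowski_functional_scaleR:
  fixes K :: "(real^'n) set" and p :: real
  assumes K: "convex_body K" "origin_symmetric K" and t: "t > 0"
  shows "(\<integral>\<^sup>+x\<in>(\<lambda>y. t *\<^sub>R y) ` K. ennreal (minkowski_functional K x powr p) \<partial>lborel) =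
    ennreal (t powr (CARD('n) + p)) * (\<integral>\<^sup>+x\<in>K. ennreal (minkowski_functional K x powr p) \<partial>lborel)"
proof -
  note [measurable] = borel_measurable_minkowski_functional[OF K]
  have comp: "compact K" using K by (simp add: convex_body_def)
  have [measurable]: "K \<in> sets borel" "(\<lambda>y. t *\<^sub>R y) ` K \<in> sets borel"
    using comp by (auto intro: borel_compact compact_scaling)
  have mem: "t *\<^sub>R x \<in> (\<lambda>y. t *\<^sub>R y) ` K \<longleftrightarrow> x \<in> K" for x using t by auto
  have "(\<integral>\<^sup>+x\<in>(\<lambda>y. t *\<^sub>R y) ` K. ennreal (minkowski_functional K x powr p) \<partial>lborel) =
    ennreal (t ^ CARD('n)) * (\<integral>\<^sup>+x. ennreal (t powr p) *
      (ennreal (minkowski_functional K x powr p) * indicator K x) \<partial>lborel)"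
    using t by (subst nn_integral_lborel_scaleR[of _ t])
      (auto simp: minkowski_functional_scaleR[OF K] minkowski_functional_nonneg[OF K] powr_mult
        ennreal_mult mem mult.assoc indicator_def intro!: arg_cong2[where f = "(*)"] nn_integral_cong)
  also have "\<dots> = ennreal (t ^ CARD('n)) * (ennreal (t powr p) *
      (\<integral>\<^sup>+x\<in>K. ennreal (minkowski_functional K x powr p) \<partial>lborel))"
    by (subst nn_integral_cmult) auto
  also have "\<dots> = ennreal (t powr (CARD('n) + p)) *
      (\<integral>\<^sup>+x\<in>K. ennreal (minkowski_functional K x powr p) \<partial>lborel)"
    using t by (simp add: powr_add powr_realpow ennreal_mult mult.assoc)
  finally show ?thesis .
qed

lemma emeasure_lborel_scaleR:
  fixes K :: "(real^'n) set"
  assumes "compact K" and t: "t > 0"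
  shows "emeasure lborel ((\<lambda>y. t *\<^sub>R y) ` K) = ennreal (t ^ CARD('n)) * emeasure lborel K"
proof -
  have [measurable]: "K \<in> sets borel" "(\<lambda>y. t *\<^sub>R y) ` K \<in> sets borel"
    using assms by (auto intro: borel_compact compact_scaling)
  have ind: "indicator ((\<lambda>y. t *\<^sub>R y) ` K) (t *\<^sub>R x) = (indicator K x :: ennreal)" for x
    using t by (auto simp: indicator_def)
  have "emeasure lborel ((\<lambda>y. t *\<^sub>R y) ` K)
      = (\<integral>\<^sup>+x. indicator ((\<lambda>y. t *\<^sub>R y) ` K) x \<partial>lborel)"
    by simp
  also have "\<dots> = ennreal (t ^ DIM(real^'n)) * (\<integral>\<^sup>+x. indicator K x \<partial>lborel)"
    using t by (subst nn_integral_lborel_scaleR[of _ t])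
      (simp_all only: ind, measurable)
  finally show ?thesis by simp
qed

section \<open>Volume of a convex body, and finiteness and positivity of integrals over it\<close>

lemma convex_body_vol_pos:
  fixes K :: "(real^'n) set"
  assumes "convex_body K"
  shows "vol K > 0"
proof (rule ccontr)
  assume "\<not> vol K > 0"
  then have "measure lebesgue K = 0" using measure_nonneg[of lebesgue K] by (simp add: vol_def)
  moreover have "K \<in> lmeasurable" using assms by (auto simp: convex_body_def lmeasurable_compact)
  ultimately have "negligible K" by (simp add: negligible_iff_measure)
  then have "negligible (interior K)" using interior_subset negligible_subset by blast
  then show False using assms open_not_negligible[of "interior K"] by (auto simp: convex_body_def)
qed

text \<open>Links \<open>vol\<close>, defined by the completed measure, to \<open>lborel\<close>,
  over which the integrals are taken; boundedness excludes an infinite value.\<close>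

lemma emeasure_convex_body:
  fixes K :: "(real^'n) set"
  assumes "convex_body K"
  shows "emeasure lborel K = ennreal (vol K)"
proof -
  have "compact K" using assms by (simp add: convex_body_def)
  then have "K \<in> sets lborel" "emeasure lborel K < \<infinity>"
    using emeasure_bounded_finite[OF compact_imp_bounded] borel_compact by auto
  then show ?thesis
    by (simp add: vol_def emeasure_eq_ennreal_measure measure_completion)
qed

text \<open>For \<open>p \<ge> 0\<close> the integrand is at most 1 on \<open>K\<close>. For
  \<open>p < 0\<close> it blows up near the origin, but halving \<open>K\<close> multiplies the
  integral by \<open>q\<close>, which is below 1 because the dimension is at least 1 and
  \<open>p > -1\<close>. On the shell between the two bodies the integrand is at most
  \<open>(1/2) powr p\<close>, which gives the constant \<open>a\<close>.\<close>

lemma nn_integral_minkowski_functional_finite: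
  fixes K :: "(real^'n) set" and p :: real
  assumes K: "convex_body K" "origin_symmetric K" and p: "- 1 < p"
  shows "(\<integral>\<^sup>+x\<in>K. ennreal (minkowski_functional K x powr p) \<partial>lborel) < \<infinity>"
proof -
  let ?N = "minkowski_functional K"
  note [measurable] = borel_measurable_minkowski_functional[OF K]
  have comp: "compact K" using K by (simp add: convex_body_def)
  then have [measurable]: "K \<in> sets borel" by (rule borel_compact)
  have N1: "?N x \<le> 1 \<longleftrightarrow> x \<in> K" for x using minkowski_functional_le_iff[OF K, of x 1] by simp
  have vol: "emeasure lborel K = ennreal (vol K)" by (rule emeasure_convex_body[OF K(1)])
  show ?thesis
  proof (cases "p \<ge> 0")
    case True
    have "(\<integral>\<^sup>+x\<in>K. ennreal (?N x powr p) \<partial>lborel) \<le> (\<integral>\<^sup>+x\<in>K. 1 \<partial>lborel)"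
      using True N1 minkowski_functional_nonneg[OF K]
      by (intro nn_integral_mono) (auto split: split_indicator intro: powr_le1)
    also have "\<dots> < \<infinity>" by (simp add: vol)
    finally show ?thesis .
  next
    case False
    define n where "n = CARD('n)"
    define q where "q = (1/2) powr (real n + p)"
    define a where "a = (1/2) powr p * vol K"
    have "real n \<ge> 1" unfolding n_def by (simp add: Suc_leI)
    then have q: "0 \<le> q" "q < 1" unfolding q_def using p
      using powr_less_mono'[of "1/2" 0 "real n + p"] by auto
    \<comment> \<open>Scaling by \<open>1/2\<close> bounds \<open>I c\<close> by \<open>a + q * I c\<close>. Truncating at \<open>c\<close> makes \<open>I c\<close> finite,
      so that the term \<open>q * I c\<close> can be absorbed.\<close>
    define I where "I c = (\<integral>\<^sup>+x\<in>K. ennreal (min (?N x powr p) (real c)) \<partial>lborel)" for c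
    have bound: "I c \<le> ennreal (a / (1 - q))" for c
    proof -
      have "I c \<le> (\<integral>\<^sup>+x\<in>K. ennreal (real c) \<partial>lborel)"
        unfolding I_def by (intro nn_integral_mono) (auto split: split_indicator intro!: ennreal_leI)
      also have "\<dots> < \<infinity>" by (simp add: nn_integral_cmult_indicator vol ennreal_mult_less_top)
      finally have fin: "I c < \<infinity>" .
      let ?H = "(\<lambda>y. (1/2) *\<^sub>R y) ` K"
      have [measurable]: "?H \<in> sets borel" using comp by (auto intro: borel_compact compact_scaling)
      have NH: "?N x \<le> 1/2 \<longleftrightarrow> x \<in> ?H" for x using minkowski_functional_le_iff[OF K, of x "1/2"] by simp
      have mem: "(1/2) *\<^sub>R x \<in> ?H \<longleftrightarrow> x \<in> K" for x by auto
      have HK: "?H \<subseteq> K" using N1 NH by (smt (verit) subsetI field_sum_of_halves)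
      have "I c = (\<integral>\<^sup>+x\<in>K - ?H. ennreal (min (?N x powr p) (real c)) \<partial>lborel) +
          (\<integral>\<^sup>+x\<in>?H. ennreal (min (?N x powr p) (real c)) \<partial>lborel)"
        unfolding I_def using HK
        by (subst nn_integral_add[symmetric])
          (use HK in \<open>force intro!: nn_integral_cong split: split_indicator\<close>)+
      also have "\<dots> \<le> ennreal a + ennreal q * I c"
      proof (rule add_mono)
        have "(\<integral>\<^sup>+x\<in>K - ?H. ennreal (min (?N x powr p) (real c)) \<partial>lborel)
            \<le> (\<integral>\<^sup>+x\<in>K. ennreal ((1/2) powr p) \<partial>lborel)"
        proof (intro nn_integral_mono)
          fix x
          have "min (?N x powr p) (real c) \<le> (1/2) powr p" if "x \<in> K - ?H"
            using that NH[of x] False by (intro min.coboundedI1 powr_mono2') auto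
          then show "ennreal (min (?N x powr p) (real c)) * indicator (K - ?H) x
              \<le> ennreal ((1/2) powr p) * indicator K x"
            by (auto split: split_indicator intro: ennreal_leI)
        qed
        also have "\<dots> = ennreal a"
          by (simp add: nn_integral_cmult_indicator vol a_def ennreal_mult vol_def)
        finally show "(\<integral>\<^sup>+x\<in>K - ?H. ennreal (min (?N x powr p) (real c)) \<partial>lborel) \<le> ennreal a" .
      next
        \<comment> \<open>Truncation reduces homogeneity to an inequality: the factor
          \<open>(1/2) powr p\<close> is at least 1, so multiplying the bound \<open>c\<close> by it
          as well only enlarges the right side.\<close>
        have *: "min (?N ((1/2) *\<^sub>R x) powr p) (real c) \<le> (1/2) powr p * min (?N x powr p) (real c)" for x
        proof -
          have "(1/2) powr p \<ge> (1::real)" using False powr_mono2'[of p "1/2" 1] by simp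
          then have "(1/2) powr p * real c \<ge> real c" by (simp add: mult_le_cancel_right1)
          moreover have "?N ((1/2) *\<^sub>R x) powr p = (1/2) powr p * ?N x powr p"
            by (subst minkowski_functional_scaleR[OF K])
              (auto simp: powr_mult[symmetric] minkowski_functional_nonneg[OF K])
          ultimately show ?thesis
            by (cases "?N x powr p \<le> real c")
              (simp_all add: min_absorb1 min_absorb2 min.coboundedI1 min.coboundedI2)
        qed
        have "(\<integral>\<^sup>+x\<in>?H. ennreal (min (?N x powr p) (real c)) \<partial>lborel)
            = ennreal ((1/2) ^ DIM(real^'n)) *
              (\<integral>\<^sup>+x\<in>K. ennreal (min (?N ((1/2) *\<^sub>R x) powr p) (real c)) \<partial>lborel)"
          by (subst nn_integral_lborel_scaleR[of _ "1/2"])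
            (auto simp: indicator_def mem intro!: arg_cong2[where f = "(*)"] nn_integral_cong)
        also have "\<dots> \<le> ennreal ((1/2) ^ DIM(real^'n)) *
              (\<integral>\<^sup>+x. ennreal ((1/2) powr p) * (ennreal (min (?N x powr p) (real c)) * indicator K x) \<partial>lborel)"
          using * by (intro mult_left_mono nn_integral_mono)
            (auto split: split_indicator intro!: ennreal_leI simp flip: ennreal_mult')
        also have "\<dots> = ennreal ((1/2) ^ DIM(real^'n)) * (ennreal ((1/2) powr p) * I c)"
          unfolding I_def by (subst nn_integral_cmult) auto
        also have "\<dots> = ennreal q * I c"
          by (simp add: q_def n_def powr_add powr_realpow ennreal_mult mult.assoc)
        finally show "(\<integral>\<^sup>+x\<in>?H. ennreal (min (?N x powr p) (real c)) \<partial>lborel) \<le> ennreal q * I c" .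
      qed
      finally have le: "I c \<le> ennreal a + ennreal q * I c" .
      obtain r where r: "r \<ge> 0" "I c = ennreal r" using fin by (cases "I c") auto
      have a0: "a \<ge> 0" by (simp add: a_def vol_def)
      have "r \<le> a + q * r"
        using le r q a0 by (simp add: ennreal_mult'[symmetric] ennreal_plus[symmetric] del: ennreal_plus)
      then have "r \<le> a / (1 - q)" using q by (simp add: field_simps)
      then show ?thesis using r by (simp add: ennreal_leI)
    qed
    \<comment> \<open>The bound on \<open>I c\<close> is uniform in \<open>c\<close>, so monotone
      convergence carries it over. The integrand is finite at every point, and truncating at the
      ceiling of its value leaves that value unchanged.\<close>
    have "(\<integral>\<^sup>+x\<in>K. ennreal (?N x powr p) \<partial>lborel) \<le>
        (\<integral>\<^sup>+x. (SUP c. ennreal (min (?N x powr p) (real c)) * indicator K x) \<partial>lborel)"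
    proof (intro nn_integral_mono)
      fix x
      have "?N x powr p \<le> real (nat \<lceil>?N x powr p\<rceil>)" by linarith
      then show "ennreal (?N x powr p) * indicator K x \<le>
          (SUP c. ennreal (min (?N x powr p) (real c)) * indicator K x)"
        by (intro SUP_upper2[of "nat \<lceil>?N x powr p\<rceil>"]) (auto simp: min_def)
    qed
    also have "\<dots> = (SUP c. I c)" unfolding I_def
      by (rule nn_integral_monotone_convergence_SUP)
        (auto simp: incseq_def le_fun_def intro!: mult_right_mono ennreal_leI)
    also have "\<dots> \<le> ennreal (a / (1 - q))" using bound by (intro SUP_least)
    finally show ?thesis by (simp add: le_less_trans)
  qed
qed

text \<open>A vanishing integral would make \<open>K\<close> a null set, against its positive
  volume.\<close>

lemma nn_integral_pos_on_convex_body: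
  fixes K :: "(real^'n) set"
  assumes "convex_body K" and [measurable]: "f \<in> borel_measurable lborel"
    and "AE x in lborel. f x \<noteq> 0"
  shows "(\<integral>\<^sup>+x\<in>K. f x \<partial>lborel) > 0"
proof (rule ccontr)
  have [measurable]: "K \<in> sets lborel" using assms by (simp add: convex_body_def borel_compact)
  assume "\<not> (\<integral>\<^sup>+x\<in>K. f x \<partial>lborel) > 0"
  then have "AE x in lborel. f x * indicator K x = 0" by (simp add: nn_integral_0_iff_AE)
  then have "AE x in lborel. x \<notin> K"
    using assms(3) by eventually_elim (auto split: split_indicator_asm)
  then have "emeasure lborel K = 0" using \<open>K \<in> sets lborel\<close>
    by (subst (asm) AE_iff_measurable[of K]) auto
  then show False using emeasure_convex_body[OF assms(1)] convex_body_vol_pos[OF assms(1)] by simp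
qed

section \<open>The functional of the polar p-centroid body\<close>

lemma measurable_abs_powr [measurable]: "(\<lambda>t. abs_powr t p) \<in> borel_measurable borel"
  unfolding abs_powr_def by measurable

text \<open>A hyperplane is a null set, so the two conventions for a negative power of 0, in
  \<open>powr\<close> and in \<open>abs_powr\<close>, give the same integral over
  \<open>x\<close>.\<close>

lemma AE_inner_nonzero:
  fixes \<xi> :: "'a::euclidean_space"
  assumes "\<xi> \<noteq> 0"
  shows "AE x in lborel. x \<bullet> \<xi> \<noteq> 0"
proof -
  have "negligible {x. \<xi> \<bullet> x = 0}" using assms by (intro negligible_hyperplane) auto
  moreover have "closed {x. \<xi> \<bullet> x = 0}" by (rule closed_hyperplane)
  ultimately have "{x. \<xi> \<bullet> x = 0} \<in> null_sets lborel"
    by (simp add: negligible_iff_null_sets null_sets_completion_iff borel_closed)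
  then show ?thesis by (auto simp: inner_commute intro: AE_I')
qed

lemma abs_powr_mult:
  assumes "c > 0"
  shows "abs_powr (c * t) p = ennreal (c powr p) * abs_powr t p"
  using assms by (auto simp: abs_powr_def abs_mult powr_mult ennreal_mult ennreal_mult_top)

text \<open>Replaces the Bochner integral by a nonnegative one, to which Tonelli applies. In the
  divergent case the two sides still agree, as the Bochner integral and \<open>enn2real\<close> of
  infinity are both 0.\<close>

lemma polar_centroid_functional_eq:
  fixes M :: "(real^'n) set"
  assumes "compact M" "\<xi> \<noteq> 0"
  shows "polar_centroid_functional p M \<xi> =
    (enn2real (\<integral>\<^sup>+x\<in>M. abs_powr (x \<bullet> \<xi>) p \<partial>lborel) / vol M) powr (1 / p)"
proof -
  have [measurable]: "M \<in> sets borel" using assms by (simp add: borel_compact)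
  have "(LINT x:M|lebesgue. \<bar>x \<bullet> \<xi>\<bar> powr p) = (LINT x|lborel. indicator M x *\<^sub>R (\<bar>x \<bullet> \<xi>\<bar> powr p))"
    unfolding set_lebesgue_integral_def by (rule integral_completion) measurable
  also have "\<dots> = enn2real (\<integral>\<^sup>+x. ennreal (indicator M x *\<^sub>R (\<bar>x \<bullet> \<xi>\<bar> powr p)) \<partial>lborel)"
    by (rule integral_eq_nn_integral) auto
  also have "(\<integral>\<^sup>+x. ennreal (indicator M x *\<^sub>R (\<bar>x \<bullet> \<xi>\<bar> powr p)) \<partial>lborel) =
      (\<integral>\<^sup>+x\<in>M. abs_powr (x \<bullet> \<xi>) p \<partial>lborel)"
    using AE_inner_nonzero[OF assms(2)]
    by (intro nn_integral_cong_AE, eventually_elim) (auto simp: abs_powr_def split: split_indicator)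
  finally show ?thesis using assms by (simp add: polar_centroid_functional_def)
qed

lemma polar_centroid_functional_scaleR:
  fixes M :: "(real^'n) set"
  assumes "compact M" "c > 0" "p \<noteq> 0"
  shows "polar_centroid_functional p M (c *\<^sub>R \<xi>) = c * polar_centroid_functional p M \<xi>"
proof (cases "\<xi> = 0")
  case False
  have [measurable]: "M \<in> sets borel" using assms by (simp add: borel_compact)
  have "(\<integral>\<^sup>+x\<in>M. abs_powr (x \<bullet> (c *\<^sub>R \<xi>)) p \<partial>lborel) =
      ennreal (c powr p) * (\<integral>\<^sup>+x\<in>M. abs_powr (x \<bullet> \<xi>) p \<partial>lborel)"
    using assms by (subst nn_integral_cmult[symmetric]) (auto simp: abs_powr_mult mult.assoc)
  then show ?thesis
    using assms False
    by (simp add: polar_centroid_functional_eq enn2real_mult powr_mult powr_powr vol_def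
        del: inner_scaleR_right flip: times_divide_eq_right) (simp add: powr_one)
qed (simp add: polar_centroid_functional_def)


text \<open>The integrand vanishes at most on a hyperplane, so the integral is positive; finiteness
  prevents \<open>enn2real\<close> from sending it to 0.\<close>

lemma polar_centroid_functional_pos:
  fixes M :: "(real^'n) set"
  assumes "convex_body M" "\<xi> \<noteq> 0" "(\<integral>\<^sup>+x\<in>M. abs_powr (x \<bullet> \<xi>) p \<partial>lborel) < \<infinity>"
  shows "0 < enn2real (\<integral>\<^sup>+x\<in>M. abs_powr (x \<bullet> \<xi>) p \<partial>lborel)" "0 < polar_centroid_functional p M \<xi>"
proof -
  have "0 < (\<integral>\<^sup>+x\<in>M. abs_powr (x \<bullet> \<xi>) p \<partial>lborel)"
    using AE_inner_nonzero[OF assms(2)]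
    by (intro nn_integral_pos_on_convex_body assms(1)) (auto simp: abs_powr_def elim: eventually_mono)
  with assms(3) show pos: "0 < enn2real (\<integral>\<^sup>+x\<in>M. abs_powr (x \<bullet> \<xi>) p \<partial>lborel)"
    by (simp add: enn2real_positive_iff)
  with convex_body_vol_pos[OF assms(1)] show "0 < polar_centroid_functional p M \<xi>"
    using assms by (subst polar_centroid_functional_eq) (auto simp: convex_body_def)
qed

section \<open>From inclusion of the bodies to comparison of the integrals\<close>

text \<open>Positivity allows \<open>\<xi>\<close> to be rescaled so that the functional of
  \<open>K\<close> equals 1. The inclusion bounds the functional of \<open>L\<close> there by 1, and
  homogeneity transfers this back to \<open>\<xi>\<close>.\<close>

lemma polar_centroid_functional_antimono:
  fixes K L :: "(real^'n) set"
  assumes "convex_body K" "convex_body L" "p \<noteq> 0"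
    and sub: "polar_centroid_body p K \<subseteq> polar_centroid_body p L"
    and pos: "0 < polar_centroid_functional p K \<xi>"
  shows "polar_centroid_functional p L \<xi> \<le> polar_centroid_functional p K \<xi>"
proof -
  let ?c = "1 / polar_centroid_functional p K \<xi>"
  have "compact K" "compact L" using assms by (auto simp: convex_body_def)
  then have scale: "polar_centroid_functional p K (?c *\<^sub>R \<xi>) = ?c * polar_centroid_functional p K \<xi>"
    "polar_centroid_functional p L (?c *\<^sub>R \<xi>) = ?c * polar_centroid_functional p L \<xi>"
    using pos \<open>p \<noteq> 0\<close> polar_centroid_functional_scaleR[of _ ?c p \<xi>] by simp_all
  then have "?c *\<^sub>R \<xi> \<in> polar_centroid_body p K" using pos by (simp add: polar_centroid_body_def)
  with sub have "?c *\<^sub>R \<xi> \<in> polar_centroid_body p L" by blast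
  then have "?c * polar_centroid_functional p L \<xi> \<le> 1"
    by (simp only: polar_centroid_body_def mem_Collect_eq scale(2))
  then show ?thesis using pos by (simp add: field_simps)
qed

lemma nn_integral_abs_powr_finite:
  fixes M :: "(real^'n) set"
  assumes "compact M" "p > 0"
  shows "(\<integral>\<^sup>+x\<in>M. abs_powr (x \<bullet> \<xi>) p \<partial>lborel) < \<infinity>"
proof -
  have [measurable]: "M \<in> sets borel" using assms by (simp add: borel_compact)
  obtain B where B: "\<And>y. y \<in> M \<Longrightarrow> norm y \<le> B"
    using assms compact_imp_bounded bounded_iff by metis
  have "(\<integral>\<^sup>+x\<in>M. abs_powr (x \<bullet> \<xi>) p \<partial>lborel) \<le> (\<integral>\<^sup>+x\<in>M. ennreal ((B * norm \<xi>) powr p) \<partial>lborel)"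
  proof (intro nn_integral_mono)
    fix x
    have "\<bar>x \<bullet> \<xi>\<bar> \<le> B * norm \<xi>" if "x \<in> M"
      using Cauchy_Schwarz_ineq2[of x \<xi>] mult_right_mono[OF B[OF that], of "norm \<xi>"] by simp
    then show "abs_powr (x \<bullet> \<xi>) p * indicator M x \<le> ennreal ((B * norm \<xi>) powr p) * indicator M x"
      using assms(2) by (auto simp: abs_powr_def split: split_indicator intro!: ennreal_leI powr_mono2)
  qed
  also have "\<dots> < \<infinity>"
    using emeasure_bounded_finite[OF compact_imp_bounded[OF assms(1)]]
    by (simp add: nn_integral_cmult_indicator ennreal_mult_less_top)
  finally show ?thesis .
qed

text \<open>For \<open>p > 0\<close> the power \<open>1 / p\<close> is increasing, so the order of
  the functionals is that of the mean values. Clearing the volumes gives a form that is linear in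
  the integrals and can be integrated in \<open>\<xi>\<close>.\<close>

lemma polar_centroid_body_subset_pos:
  fixes K L :: "(real^'n) set"
  assumes "convex_body K" "convex_body L" "p > 0" "\<xi> \<noteq> 0"
    and "polar_centroid_body p K \<subseteq> polar_centroid_body p L"
  shows "ennreal (vol K) * (\<integral>\<^sup>+x\<in>L. abs_powr (x \<bullet> \<xi>) p \<partial>lborel)
    \<le> ennreal (vol L) * (\<integral>\<^sup>+x\<in>K. abs_powr (x \<bullet> \<xi>) p \<partial>lborel)"
proof -
  define JK where "JK = (\<integral>\<^sup>+x\<in>K. abs_powr (x \<bullet> \<xi>) p \<partial>lborel)"
  define JL where "JL = (\<integral>\<^sup>+x\<in>L. abs_powr (x \<bullet> \<xi>) p \<partial>lborel)"
  have comp: "compact K" "compact L" using assms by (auto simp: convex_body_def)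
  have fin: "JK < \<infinity>" "JL < \<infinity>"
    unfolding JK_def JL_def by (intro nn_integral_abs_powr_finite comp assms)+
  note pos = polar_centroid_functional_pos[OF assms(1,4) fin(1)[unfolded JK_def]]
  have "polar_centroid_functional p L \<xi> \<le> polar_centroid_functional p K \<xi>"
    using assms pos by (intro polar_centroid_functional_antimono) auto
  then have "(enn2real JL / vol L) powr (1 / p) \<le> (enn2real JK / vol K) powr (1 / p)"
    using comp assms by (simp add: polar_centroid_functional_eq JK_def JL_def)
  then have "\<not> enn2real JK / vol K < enn2real JL / vol L"
    using assms(3) powr_less_mono2[of "1 / p" "enn2real JK / vol K" "enn2real JL / vol L"]
    by (auto simp: vol_def)
  then have "vol K * enn2real JL \<le> vol L * enn2real JK"
    using convex_body_vol_pos[OF assms(1)] convex_body_vol_pos[OF assms(2)] by (simp add: field_simps not_less)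
  then have "ennreal (vol K * enn2real JL) \<le> ennreal (vol L * enn2real JK)" by (rule ennreal_leI)
  then show ?thesis using fin by (simp add: ennreal_mult vol_def JK_def JL_def)
qed

text \<open>If the integral over \<open>K\<close> diverges, the functional of \<open>K\<close> takes the junk value 0 and the
  inclusion carries no information, hence the last assumption.\<close>

lemma polar_centroid_body_subset_neg:
  fixes K L :: "(real^'n) set"
  assumes "convex_body K" "convex_body L" "p < 0" "\<xi> \<noteq> 0"
    and "polar_centroid_body p K \<subseteq> polar_centroid_body p L"
    and finK: "(\<integral>\<^sup>+x\<in>K. abs_powr (x \<bullet> \<xi>) p \<partial>lborel) < \<infinity>"
  shows "ennreal (vol L) * (\<integral>\<^sup>+x\<in>K. abs_powr (x \<bullet> \<xi>) p \<partial>lborel)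
    \<le> ennreal (vol K) * (\<integral>\<^sup>+x\<in>L. abs_powr (x \<bullet> \<xi>) p \<partial>lborel)"
proof -
  define JK where "JK = (\<integral>\<^sup>+x\<in>K. abs_powr (x \<bullet> \<xi>) p \<partial>lborel)"
  define JL where "JL = (\<integral>\<^sup>+x\<in>L. abs_powr (x \<bullet> \<xi>) p \<partial>lborel)"
  have comp: "compact K" "compact L" using assms by (auto simp: convex_body_def)
  note vol = convex_body_vol_pos[OF assms(1)] convex_body_vol_pos[OF assms(2)]
  note posK = polar_centroid_functional_pos[OF assms(1,4) finK]
  have "ennreal (vol L) * JK \<le> ennreal (vol K) * JL"
  \<comment> \<open>An infinite \<open>JL\<close> makes the right side infinite, as
    \<open>vol K > 0\<close>; the inclusion is used only when \<open>JL\<close> is finite.\<close>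
  proof (cases "JL < \<infinity>")
    case False
    then show ?thesis using vol by (simp add: less_top[symmetric] ennreal_mult_top)
  next
    case True
    note posL = polar_centroid_functional_pos[OF assms(2,4) True[unfolded JL_def]]
    have "polar_centroid_functional p L \<xi> \<le> polar_centroid_functional p K \<xi>"
      using assms posK by (intro polar_centroid_functional_antimono) auto
    then have le: "(enn2real JL / vol L) powr (1 / p) \<le> (enn2real JK / vol K) powr (1 / p)"
      using comp assms by (simp add: polar_centroid_functional_eq JK_def JL_def)
    \<comment> \<open>The exponent \<open>1 / p\<close> is negative, so the order of the mean values
      is opposite to that of the functionals.\<close>
    have "enn2real JK / vol K \<le> enn2real JL / vol L"
    proof (rule ccontr)
      assume "\<not> ?thesis"
      then have "(enn2real JK / vol K) powr (1 / p) < (enn2real JL / vol L) powr (1 / p)"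
        using assms(3) posL posK vol by (intro powr_less_mono2_neg) (auto simp: JL_def)
      with le show False by simp
    qed
    then have "vol L * enn2real JK \<le> vol K * enn2real JL" using vol by (simp add: field_simps)
    then have "ennreal (vol L * enn2real JK) \<le> ennreal (vol K * enn2real JL)" by (rule ennreal_leI)
    then show ?thesis using True finK by (simp add: ennreal_mult vol_def JK_def)
  qed
  then show ?thesis by (simp add: JK_def JL_def)
qed

section \<open>Integration against the representing measure\<close>

text \<open>Tonelli, with \<open>\<mu>\<close> sigma-finite because it is finite. The representation
  of \<open>N\<close> is available only for \<open>x \<noteq> 0\<close>, that is, almost
  everywhere.\<close>

lemma nn_integral_Lp_embedding:
  fixes M :: "(real^'n) set"
  assumes "finite_measure \<mu>" and sets: "sets \<mu> = sets (restrict_space borel (sphere 0 1))"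
    and N: "\<And>x. x \<noteq> 0 \<Longrightarrow> ennreal (N x powr p) = (\<integral>\<^sup>+ \<xi>. abs_powr (x \<bullet> \<xi>) p \<partial>\<mu>)"
    and [measurable]: "M \<in> sets borel"
  shows "(\<lambda>\<xi>. \<integral>\<^sup>+x\<in>M. abs_powr (x \<bullet> \<xi>) p \<partial>lborel) \<in> borel_measurable \<mu>"
    and "(\<integral>\<^sup>+x\<in>M. ennreal (N x powr p) \<partial>lborel) =
      (\<integral>\<^sup>+\<xi>. (\<integral>\<^sup>+x\<in>M. abs_powr (x \<bullet> \<xi>) p \<partial>lborel) \<partial>\<mu>)"
proof -
  interpret finite_measure \<mu> by fact
  interpret pair_sigma_finite lborel \<mu> by standard
  \<comment> \<open>The measurable sets of \<open>\<mu>\<close> are traces of Borel sets on the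
    sphere, so Borel functions of vectors are measurable for \<open>\<mu>\<close> through the
    inclusion map.\<close>
  have [measurable]: "(\<lambda>x. x) \<in> measurable \<mu> borel"
    using measurable_restrict_space1[OF measurable_ident, of borel "sphere 0 1"]
    by (simp add: measurable_cong_sets[OF sets refl] id_def)
  have meas: "(\<lambda>(x, \<xi>). abs_powr (x \<bullet> \<xi>) p * indicator M x) \<in> borel_measurable (lborel \<Otimes>\<^sub>M \<mu>)"
    by measurable
  have meas': "(\<lambda>(\<xi>, x). abs_powr (x \<bullet> \<xi>) p * indicator M x) \<in> borel_measurable (\<mu> \<Otimes>\<^sub>M lborel)"
    by measurable
  from lborel.borel_measurable_nn_integral[OF meas']
  show "(\<lambda>\<xi>. \<integral>\<^sup>+x\<in>M. abs_powr (x \<bullet> \<xi>) p \<partial>lborel) \<in> borel_measurable \<mu>" by simp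
  have "AE x in lborel. x \<noteq> (0::real^'n)" by (rule AE_lborel_singleton)
  then have "(\<integral>\<^sup>+x\<in>M. ennreal (N x powr p) \<partial>lborel) =
      (\<integral>\<^sup>+x. (\<integral>\<^sup>+\<xi>. abs_powr (x \<bullet> \<xi>) p * indicator M x \<partial>\<mu>) \<partial>lborel)"
    by (intro nn_integral_cong_AE, eventually_elim) (simp add: N nn_integral_multc)
  also have "\<dots> = (\<integral>\<^sup>+\<xi>. (\<integral>\<^sup>+x\<in>M. abs_powr (x \<bullet> \<xi>) p \<partial>lborel) \<partial>\<mu>)"
    using Fubini'[of "\<lambda>x \<xi>. abs_powr (x \<bullet> \<xi>) p * indicator M x"] meas by simp
  finally show "(\<integral>\<^sup>+x\<in>M. ennreal (N x powr p) \<partial>lborel) =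
      (\<integral>\<^sup>+\<xi>. (\<integral>\<^sup>+x\<in>M. abs_powr (x \<bullet> \<xi>) p \<partial>lborel) \<partial>\<mu>)" .
qed

theorem theorem2p1:
  fixes p :: real and K L :: "(real^'n) set"
  assumes "- 1 < p" and "p < 1" and "p \<noteq> 0"
    and "convex_body K" and "origin_symmetric K"
    and "convex_body L" and "origin_symmetric L"
    and "embeds_in_Lp p (minkowski_functional K)"
    and "polar_centroid_body p K \<subseteq> polar_centroid_body p L"
  shows "vol L \<le> vol K"
proof (rule ccontr)
  assume neg: "\<not> vol L \<le> vol K"
  let ?N = "minkowski_functional K"
  let ?J = "\<lambda>M \<xi>. \<integral>\<^sup>+x\<in>M. abs_powr (x \<bullet> \<xi>) p \<partial>lborel"
  define I where "I M = (\<integral>\<^sup>+x\<in>M. ennreal (?N x powr p) \<partial>lborel)" for M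
  note K = assms(4,5)
  note [measurable] = borel_measurable_minkowski_functional[OF K]
  note vol_pos = convex_body_vol_pos[OF assms(4)] convex_body_vol_pos[OF assms(6)]
  have comp: "compact K" "compact L" using assms by (auto simp: convex_body_def)
  then have [measurable]: "K \<in> sets borel" "L \<in> sets borel" by (auto intro: borel_compact)
  obtain \<mu> where sets: "sets \<mu> = sets (restrict_space borel (sphere (0::real^'n) 1))"
    and fin: "finite_measure \<mu>"
    and N: "\<And>x. x \<noteq> 0 \<Longrightarrow> ennreal (?N x powr p) = (\<integral>\<^sup>+ \<xi>. abs_powr (x \<bullet> \<xi>) p \<partial>\<mu>)"
    using assms(8) unfolding embeds_in_Lp_def by blast
  have [measurable]: "?J M \<in> borel_measurable \<mu>" if "M \<in> sets borel" for M
    by (rule nn_integral_Lp_embedding(1)[OF fin sets N that])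
  have I: "I M = (\<integral>\<^sup>+\<xi>. ?J M \<xi> \<partial>\<mu>)" if "M \<in> sets borel" for M
    unfolding I_def by (rule nn_integral_Lp_embedding(2)[OF fin sets N that])
  \<comment> \<open>\<open>\<mu>\<close> lives on the unit sphere, so every direction that occurs is
    nonzero, as the comparison lemmas require.\<close>
  have space: "\<xi> \<noteq> 0" if "\<xi> \<in> space \<mu>" for \<xi>
    using that sets_eq_imp_space_eq[OF sets] by (auto simp: space_restrict_space)
  have IK_fin: "I K < \<infinity>"
    unfolding I_def by (rule nn_integral_minkowski_functional_finite[OF K assms(1)])
  have "AE x in lborel. ennreal (?N x powr p) \<noteq> 0"
    using AE_lborel_singleton[of "0::real^'n"]
  proof eventually_elim
    case (elim x)
    then show ?case using minkowski_functional_pos[OF K, of x] by simp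
  qed
  then have IK_pos: "I K > 0"
    unfolding I_def by (intro nn_integral_pos_on_convex_body assms(4)) auto
  \<comment> \<open>A positive real value of \<open>I K\<close>, which can be cancelled from the
    final inequalities.\<close>
  define r where "r = enn2real (I K)"
  have r: "I K = ennreal r" "r > 0"
    using IK_fin IK_pos by (auto simp: r_def enn2real_positive_iff)
  define n where "n = CARD('n)"
  have n: "n > 0" by (simp add: n_def)
  define t where "t = (vol L / vol K) powr (1 / real n)"
  have "1 < vol L / vol K" using neg vol_pos by simp
  then have t: "t > 1" unfolding t_def using n by (intro gr_one_powr) auto
  have tn: "t ^ n * vol K = vol L"
    using t n vol_pos by (simp add: t_def powr_powr flip: powr_realpow)
  define T where "T = (\<lambda>y. t *\<^sub>R y) ` K"
  have [measurable]: "T \<in> sets borel" unfolding T_def using comp by (auto intro: borel_compact compact_scaling)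
  have T: "x \<in> T \<longleftrightarrow> ?N x \<le> t" for x
    using minkowski_functional_le_iff[OF K, of x t] t by (simp add: T_def)
  have eL: "emeasure lborel L = ennreal (vol L)" by (rule emeasure_convex_body[OF assms(6)])
  have "emeasure lborel T = ennreal (t ^ n) * ennreal (vol K)"
    unfolding T_def n_def using emeasure_lborel_scaleR[OF comp(1), of t] t
    by (simp add: emeasure_convex_body[OF assms(4)])
  also have "\<dots> = ennreal (vol L)" using t by (simp add: tn flip: ennreal_mult')
  finally have eT: "emeasure lborel T = ennreal (vol L)" .
  have "I T = ennreal (t powr (real n + p)) * I K"
    unfolding I_def T_def n_def using nn_integral_minkowski_functional_scaleR[OF K, of t p] t by simp
  then have IT: "I T = ennreal (t ^ n * t powr p * r)"
    using t r by (simp add: ennreal_mult powr_add powr_realpow)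
  show False
  proof (cases "p > 0")
    case True
    \<comment> \<open>\<open>T\<close> and \<open>L\<close> have equal measure, and \<open>T\<close>
      is where the norm is at most \<open>t\<close>, so \<open>t powr p\<close> separates the values
      on \<open>T - L\<close> from those on \<open>L - T\<close>.\<close>
    have "I T \<le> I L"
      unfolding I_def
    proof (rule nn_integral_bathtub[where c = "ennreal (t powr p)"])
      show "ennreal (?N x powr p) \<le> ennreal (t powr p)" if "x \<in> T - L" for x
        using that True T minkowski_functional_nonneg[OF K] by (intro ennreal_leI powr_mono2) auto
      show "ennreal (t powr p) \<le> ennreal (?N x powr p)" if "x \<in> L - T" for x
        using that True T[of x] t by (intro ennreal_leI powr_mono2) auto
    qed (auto simp: eL eT)
    then have "ennreal (vol K) * I T \<le> ennreal (vol K) * I L" by (intro mult_left_mono) auto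
    also have "\<dots> = (\<integral>\<^sup>+\<xi>. ennreal (vol K) * ?J L \<xi> \<partial>\<mu>)"
      by (simp add: I nn_integral_cmult)
    also have "\<dots> \<le> (\<integral>\<^sup>+\<xi>. ennreal (vol L) * ?J K \<xi> \<partial>\<mu>)"
      by (intro nn_integral_mono polar_centroid_body_subset_pos assms True space)
    also have "\<dots> = ennreal (vol L) * I K" by (simp add: I nn_integral_cmult)
    finally have "ennreal (vol K * (t ^ n * t powr p * r)) \<le> ennreal (vol L * r)"
      using t r vol_pos by (simp add: IT ennreal_mult)
    then have "vol L * r * t powr p \<le> vol L * r"
      using r vol_pos by (simp add: ennreal_le_iff algebra_simps flip: tn)
    then have "t powr p \<le> 1" using r vol_pos by (simp add: mult_le_cancel_left1)
    moreover have "t powr p > 1" using t True by (rule gr_one_powr)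
    ultimately show False by simp
  next
    case False
    then have p: "p < 0" using assms(3) by simp
    \<comment> \<open>A negative power is decreasing, so \<open>T\<close> and \<open>L\<close>
      exchange roles in the bathtub principle.\<close>
    have "I L \<le> I T"
      unfolding I_def
    proof (rule nn_integral_bathtub[where c = "ennreal (t powr p)"])
      show "ennreal (t powr p) \<le> ennreal (?N x powr p)" if "x \<in> T - L" for x
      proof -
        \<comment> \<open>The origin has to be kept out of \<open>T - L\<close>: there
          \<open>0 powr p = 0\<close> would violate the lower bound.\<close>
        have "0 \<in> L" using origin_symmetric_zero_interior[OF assms(6,7)] interior_subset by blast
        then have "x \<noteq> 0" using that by auto
        then show ?thesis
          using that p T minkowski_functional_pos[OF K] by (intro ennreal_leI powr_mono2') auto
      qed
      show "ennreal (?N x powr p) \<le> ennreal (t powr p)" if "x \<in> L - T" for x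
        using that p T[of x] t by (intro ennreal_leI powr_mono2') auto
    qed (auto simp: eL eT)
    have "(\<integral>\<^sup>+\<xi>. ?J K \<xi> \<partial>\<mu>) \<noteq> \<infinity>" using IK_fin by (simp add: I)
    \<comment> \<open>The comparison for negative \<open>p\<close> needs a finite integral over
      \<open>K\<close>; finiteness of \<open>I K\<close> provides this for almost every
      direction.\<close>
    then have "AE \<xi> in \<mu>. ?J K \<xi> \<noteq> \<infinity>" by (intro nn_integral_PInf_AE) auto
    then have AE: "AE \<xi> in \<mu>. ennreal (vol L) * ?J K \<xi> \<le> ennreal (vol K) * ?J L \<xi>"
      using AE_space
    proof eventually_elim
      case (elim \<xi>)
      then show ?case
        by (intro polar_centroid_body_subset_neg assms p space) (auto simp: less_top)
    qed
    have "ennreal (vol L) * I K = (\<integral>\<^sup>+\<xi>. ennreal (vol L) * ?J K \<xi> \<partial>\<mu>)"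
      by (simp add: I nn_integral_cmult)
    also have "\<dots> \<le> (\<integral>\<^sup>+\<xi>. ennreal (vol K) * ?J L \<xi> \<partial>\<mu>)"
      by (rule nn_integral_mono_AE[OF AE])
    also have "\<dots> = ennreal (vol K) * I L" by (simp add: I nn_integral_cmult)
    also have "\<dots> \<le> ennreal (vol K) * I T" using \<open>I L \<le> I T\<close> by (intro mult_left_mono) auto
    finally have "ennreal (vol L * r) \<le> ennreal (vol K * (t ^ n * t powr p * r))"
      using t r vol_pos by (simp add: IT ennreal_mult)
    then have "vol L * r \<le> vol L * r * t powr p"
      using r vol_pos t by (simp add: ennreal_le_iff algebra_simps flip: tn)
    then have "1 \<le> t powr p" using r vol_pos by (simp add: mult_le_cancel_left1)
    moreover have "t powr p < 1" using t p by (rule powr_less_one)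
    ultimately show False by simp
  qed
qed

end
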